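(* Let $G=G_1\oplus_e G_2$ be the $2$-sum of two graphs $G_1$ and $G_2$ along an edge $e$. (i) If both $G_1$ and $G_2$ admit $S^1$-flows, then both $G$ and $G-e$ admit $S^1$-flows. (ii) If $G_1/e$ admits a nowhere-zero $3$-flow and $G_2$ admits an $S^1$-flow, then $G$ admits an $S^1$-flow. (iii) If $G_1$ and $G_2-e$ both admit $S^1$-flows, then $G$ admits an $S^1$-flow. (iv) If $G_1$ and $G_2$ are bridgeless and both $G_1/e$ and $G_2/e$ admit nowhere-zero $3$-flows, then $G$ admits an $S^1$-flow.
   Context: All graphs are finite and loopless; parallel edges are allowed. For two graphs $G_1,G_2$, a graph $G$ is the $2$-sum of $G_1$ and $G_2$ along an edge $e=uv$, written $G=G_1\oplus_e G_2$, if $V(G)=V(G_1)\cup V(G_2)$, $E(G)=E(G_1)\cup E(G_2)$, $E(G_1)\cap E(G_2)=\{e\}$ and $V(G_1)\cap V(G_2)=\{u,v\}$ (i.e. $G_1$ and $G_2$ are glued along $e$, and $e$ is kept). $H/e$ denotes the graph obtained from $H$ by identifying the two ends of $e$ and deleting all resulting loops, retaining parallel edges. For an orientation $D$ and $f:E(G)\to\mathbb{R}^d$, the boundary is $\partial_D f(v)=\sum_{e\in E_D^+(v)}f(e)-\sum_{e\in E_D^-(v)}f(e)$ (out-edges minus in-edges). For $\Omega\subseteq\mathbb{R}^d$, an $\Omega$-flow of $G$ is a pair $(D,f)$ with $D$ an orientation, $f:E(G)\to\Omega$ and $\partial_D f(v)=\mathbf{0}$ for every $v$. A nowhere-zero $3$-flow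 is a $\{\pm1,\pm2\}$-flow; an $S^1$-flow is the case $\Omega=S^1=\{\mathbf{x}\in\mathbb{R}^2:\|\mathbf{x}\|=1\}$. *)

theory Defs
  imports "HOL-Analysis.Analysis" "Graph_Theory.Digraph"
begin

text \<open>Undirected multigraphs. Edges have their own identity, so two different edges with the
  same set of ends are parallel edges; requiring two distinct ends rules out loops.\<close>

record ('v, 'e) mgraph =
  vertices :: "'v set"
  edges :: "'e set"
  ends :: "'e \<Rightarrow> 'v set"

locale multigraph =
  fixes G :: "('v, 'e) mgraph"
  assumes finite_vertices: "finite (vertices G)"
    and finite_edges: "finite (edges G)"
    and ends_subset: "\<And>e. e \<in> edges G \<Longrightarrow> ends G e \<subseteq> vertices G"
    and loopless: "\<And>e. e \<in> edges G \<Longrightarrow> card (ends G e) = 2"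

definition two_sum ::
  "('v, 'e) mgraph \<Rightarrow> 'e \<Rightarrow> ('v, 'e) mgraph \<Rightarrow> ('v, 'e) mgraph \<Rightarrow> bool" where
  "two_sum G e G1 G2 \<longleftrightarrow>
     vertices G = vertices G1 \<union> vertices G2 \<and>
     edges G = edges G1 \<union> edges G2 \<and>
     edges G1 \<inter> edges G2 = {e} \<and>
     vertices G1 \<inter> vertices G2 = ends G e \<and>
     (\<forall>f\<in>edges G1. ends G f = ends G1 f) \<and>
     (\<forall>f\<in>edges G2. ends G f = ends G2 f)"

definition delete_edge :: "('v, 'e) mgraph \<Rightarrow> 'e \<Rightarrow> ('v, 'e) mgraph" where
  "delete_edge G e = G\<lparr>edges := edges G - {e}\<rparr>"

text \<open>Vertices of the contraction are the classes of identified vertices: the two ends of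
  \<open>e\<close> form one class, all other classes are singletons. In a loopless graph the edges that
  become loops are exactly \<open>e\<close> and the edges parallel to it.\<close>

definition contract_class :: "('v, 'e) mgraph \<Rightarrow> 'e \<Rightarrow> 'v \<Rightarrow> 'v set" where
  "contract_class G e v = (if v \<in> ends G e then ends G e else {v})"

definition contract_edge :: "('v, 'e) mgraph \<Rightarrow> 'e \<Rightarrow> ('v set, 'e) mgraph" where
  "contract_edge G e =
     \<lparr>vertices = contract_class G e ` vertices G,
      edges = {f \<in> edges G. ends G f \<noteq> ends G e},
      ends = (\<lambda>f. contract_class G e ` ends G f)\<rparr>"

definition linked :: "('v, 'e) mgraph \<Rightarrow> 'v \<Rightarrow> 'v \<Rightarrow> bool" where
  "linked G u v \<longleftrightarrow> (u, v) \<in> {(x, y). \<exists>f\<in>edges G. ends G f = {x, y}}\<^sup>*"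

definition bridge :: "('v, 'e) mgraph \<Rightarrow> 'e \<Rightarrow> bool" where
  "bridge G e \<longleftrightarrow>
     e \<in> edges G \<and> (\<exists>u v. ends G e = {u, v} \<and> \<not> linked (delete_edge G e) u v)"

definition bridgeless :: "('v, 'e) mgraph \<Rightarrow> bool" where
  "bridgeless G \<longleftrightarrow> (\<forall>e. \<not> bridge G e)"

definition orientation :: "('v, 'e) mgraph \<Rightarrow> ('v, 'e) pre_digraph \<Rightarrow> bool" where
  "orientation G D \<longleftrightarrow>
     verts D = vertices G \<and> arcs D = edges G \<and>
     (\<forall>e\<in>edges G. {tail D e, head D e} = ends G e)"

definition boundary ::
  "('v, 'e) pre_digraph \<Rightarrow> ('e \<Rightarrow> 'a::euclidean_space) \<Rightarrow> 'v \<Rightarrow> 'a" where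
  "boundary D f v = (\<Sum>e\<in>out_arcs D v. f e) - (\<Sum>e\<in>in_arcs D v. f e)"

definition omega_flow ::
  "'a::euclidean_space set \<Rightarrow> ('v, 'e) mgraph \<Rightarrow> ('v, 'e) pre_digraph \<Rightarrow> ('e \<Rightarrow> 'a) \<Rightarrow> bool" where
  "omega_flow \<Omega> G D f \<longleftrightarrow>
     orientation G D \<and> (\<forall>e\<in>edges G. f e \<in> \<Omega>) \<and> (\<forall>v\<in>vertices G. boundary D f v = 0)"

definition admits_flow :: "'a::euclidean_space set \<Rightarrow> ('v, 'e) mgraph \<Rightarrow> bool" where
  "admits_flow \<Omega> G \<longleftrightarrow> (\<exists>D f. omega_flow \<Omega> G D f)"

definition admits_S1_flow :: "('v, 'e) mgraph \<Rightarrow> bool" where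
  "admits_S1_flow G \<longleftrightarrow> admits_flow {x :: real^2. norm x = 1} G"

definition admits_nz3_flow :: "('v, 'e) mgraph \<Rightarrow> bool" where
  "admits_nz3_flow G \<longleftrightarrow> admits_flow {1, -1, 2, -2 :: real} G"

end

theory Submission
  imports Defs
begin

text \<open>Both graphs contain \<open>e = uv\<close>, and what remains of \<open>G\<close> consists of the two edge sets
  \<open>A = E(G\<^sub>1) - e\<close> and \<open>B = E(G\<^sub>2) - e\<close>, which meet only in \<open>u\<close> and \<open>v\<close>. The idea is to forget
  everything about a part except what it can send from \<open>u\<close> to \<open>v\<close>: an assignment of unit vectors
  to \<open>A\<close> with zero boundary away from \<open>u\<close> and \<open>v\<close> has some boundary \<open>w\<close> at \<open>u\<close> and \<open>- w\<close> at \<open>v\<close>.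
  Orthogonal maps preserve unit vectors, so only the length of \<open>w\<close> matters
  (\<open>carries_rotate\<close>); say that \<open>A\<close> carries \<open>r = |w|\<close>. Disjoint parts add their vectors, and an
  \<open>S\<^sup>1\<close>-flow of the whole graph is the case \<open>w = 0\<close>. If \<open>A\<close>, \<open>B\<close> carry \<open>r\<close>, \<open>s\<close>, then
  \<open>A \<union> B\<close> carries the length of the sum of any two vectors of lengths \<open>r\<close> and \<open>s\<close>. The edge
  \<open>e\<close> carries \<open>1\<close>. So \<open>G\<close> has an \<open>S\<^sup>1\<close>-flow as soon as \<open>r\<close>, \<open>s\<close> and \<open>1\<close> are the sides of a
  possibly degenerate triangle that one can choose from what \<open>A\<close> and \<open>B\<close> carry.

  An \<open>S\<^sup>1\<close>-flow of \<open>G\<^sub>2\<close> shows that \<open>B\<close> carries \<open>1\<close>, and one of \<open>G\<^sub>2 - e\<close> that \<open>B\<close> carries \<open>0\<close>.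
  It remains to extract something from a nowhere-zero \<open>3\<close>-flow \<open>f\<close> of \<open>G\<^sub>1 / e\<close>. Lifted back to
  \<open>G\<^sub>1\<close>, it is defined on all edges that are not parallel to \<open>e\<close> and has some integer boundary
  \<open>c\<close> at \<open>u\<close> and \<open>- c\<close> at \<open>v\<close>. Two facts turn it into unit vectors.

  First (\<open>S1_of_nz3\<close>), the edges with \<open>|f| = 1\<close> have even degree at every vertex except that
  the degrees of \<open>u\<close> and \<open>v\<close> have the parity of \<open>c\<close>. Hence these edges have a \<open>\<plusminus>1\<close>-valued
  \<open>s\<close> that is balanced at all vertices up to the parity (\<open>balanced_signing\<close>). With \<open>s = 0\<close> on the
  other edges, \<open>(f / 2, s \<surd>3 / 2)\<close> is a unit vector on every edge. Its boundary at \<open>u\<close> has first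
  coordinate \<open>c / 2\<close> and second coordinate \<open>0\<close> or \<open>\<plusminus>\<surd>3 / 2\<close>. So \<open>c = 0\<close>, \<open>\<plusminus>1\<close>, \<open>\<plusminus>3\<close> gives that
  the length \<open>0\<close>, \<open>1\<close>, \<open>\<surd>3\<close> is carried.

  Second (\<open>nz3_shift\<close>), subtracting \<open>3\<close> along a path from \<open>u\<close> to \<open>v\<close> that follows the direction of
  positive flow keeps all values in \<open>{\<plusminus>1, \<plusminus>2}\<close> and lowers \<open>c\<close> by \<open>3\<close>. Such a path exists if
  \<open>c > 0\<close>, and also if \<open>c = 0\<close> and \<open>u\<close>, \<open>v\<close> are connected. So one can reach \<open>c = 0\<close> or \<open>\<plusminus>1\<close>, and
  if \<open>e\<close> is not a bridge, then \<open>c = 0\<close> can be exchanged for \<open>c = -3\<close>. Together with a treatment of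
  the edges parallel to \<open>e\<close>, this yields \<open>carries_of_contract\<close>: \<open>A\<close> carries \<open>0\<close> or \<open>1\<close>, and in the
  bridgeless case it carries \<open>1\<close> or both \<open>0\<close> and \<open>\<surd>3\<close>. The triangles with sides \<open>(1,1,1)\<close>,
  \<open>(0,1,1)\<close>, \<open>(1,0,1)\<close> and \<open>(\<surd>3,\<surd>3,1)\<close> cover all cases.\<close>

section \<open>Boundaries with respect to a fixed orientation\<close>

text \<open>The boundary for tail and head functions \<open>t\<close> and \<open>h\<close>, restricted to an edge set \<open>A\<close>. One
  orientation is fixed for all parts of the graph, because every value set in use is symmetric
  under negation; values in any abelian group allow integer flows and vector flows to be treated
  alike.\<close>

definition net :: "('e \<Rightarrow> 'v) \<Rightarrow> ('e \<Rightarrow> 'v) \<Rightarrow> 'e set \<Rightarrow> ('e \<Rightarrow> 'a::ab_group_add) \<Rightarrow> 'v \<Rightarrow> 'a" where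
  "net t h A f x = (\<Sum>a\<in>A. (if t a = x then f a else 0) - (if h a = x then f a else 0))"

lemma net_add: "net t h A (\<lambda>a. f a + g a) x = net t h A f x + net t h A g x"
  unfolding net_def sum.distrib[symmetric] by (rule sum.cong) auto

lemma net_additive:
  assumes "Modules.additive L"
  shows "net t h A (\<lambda>a. L (f a)) x = L (net t h A f x)"
proof -
  interpret Modules.additive L by fact
  show ?thesis
    unfolding net_def sum by (rule sum.cong) (auto simp: zero diff minus)
qed

lemma net_uminus: "net t h A (\<lambda>a. - f a) x = - net t h A f x"
  by (rule net_additive) (simp add: Modules.additive_def)

lemma net_scale_int: "net t h A (\<lambda>a. k * f a) x = k * net t h A f x" for k :: int
  by (rule net_additive) (simp add: Modules.additive_def algebra_simps)

lemma net_cong: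
  assumes "\<And>a. a \<in> A \<Longrightarrow> f a = g a"
  shows "net t h A f x = net t h A g x"
  unfolding net_def by (rule sum.cong) (auto simp: assms)

lemma net_union:
  assumes "finite A" "finite B" "A \<inter> B = {}"
  shows "net t h (A \<union> B) f x = net t h A f x + net t h B f x"
  unfolding net_def by (rule sum.union_disjoint) (use assms in auto)

lemma net_insert:
  assumes "finite A" "a \<notin> A"
  shows "net t h (insert a A) f x
    = (if t a = x then f a else 0) - (if h a = x then f a else 0) + net t h A f x"
  unfolding net_def by (rule sum.insert) (use assms in auto)

lemma net_outside:
  assumes "\<And>a. a \<in> A \<Longrightarrow> t a \<noteq> x \<and> h a \<noteq> x"
  shows "net t h A f x = 0"
  unfolding net_def by (rule sum.neutral) (use assms in auto)

lemma sum_net: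
  assumes "finite X"
  shows "(\<Sum>x\<in>X. net t h A f x)
    = (\<Sum>a\<in>A. (if t a \<in> X then f a else 0) - (if h a \<in> X then f a else 0))"
proof -
  have "(\<Sum>x\<in>X. net t h A f x)
      = (\<Sum>a\<in>A. \<Sum>x\<in>X. (if t a = x then f a else 0) - (if h a = x then f a else 0))"
    unfolding net_def by (rule sum.swap)
  also have "\<dots> = (\<Sum>a\<in>A. (if t a \<in> X then f a else 0) - (if h a \<in> X then f a else 0))"
    using assms by (intro sum.cong) (auto simp: sum_subtractf)
  finally show ?thesis .
qed

lemma sum_net_eq_0:
  assumes "finite X" "t ` A \<subseteq> X" "h ` A \<subseteq> X"
  shows "(\<Sum>x\<in>X. net t h A f x) = 0"
  unfolding sum_net[OF assms(1)] by (rule sum.neutral) (use assms in auto)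

text \<open>In the application \<open>f\<close> is an integer flow and \<open>g\<close> a signing of its odd edges: the signing
  inherits the parity of the flow at every vertex.\<close>

lemma even_net_cong:
  fixes f g :: "'e \<Rightarrow> int"
  assumes "\<And>a. a \<in> A \<Longrightarrow> even (f a) \<longleftrightarrow> even (g a)"
  shows "even (net t h A f x) \<longleftrightarrow> even (net t h A g x)"
proof -
  have "even (net t h A f x + net t h A g x)"
    unfolding net_add[symmetric] unfolding net_def
    by (rule dvd_sum) (use assms in auto)
  then show ?thesis by simp
qed

section \<open>Augmenting paths and balanced signings\<close>

text \<open>This replaces reachability along edges traversed in the direction of positive flow. A path is
  represented by the function \<open>q\<close> that is \<open>sgn \<sigma>\<close> on its edges and zero elsewhere; all that later
  proofs use about it is its boundary. Let \<open>X\<close> be a maximal set each of whose points \<open>y\<close> is the end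
  of such a \<open>q\<close> supported inside \<open>X\<close>. If the flow left \<open>X\<close> along an edge, its far end could be
  added: that edge is new to \<open>q\<close>, because \<open>q\<close> lives inside \<open>X\<close>. So all flow across the border of
  \<open>X\<close> enters \<open>X\<close>, and the total boundary of \<open>X\<close> is at most zero, with equality only if no
  flow crosses the border.\<close>

lemma augmenting_set:
  fixes \<sigma> :: "'e \<Rightarrow> int"
  assumes A: "finite A" and V: "finite V" "t ` A \<subseteq> V" "h ` A \<subseteq> V" and x: "x \<in> V"
  obtains X where "x \<in> X" "X \<subseteq> V"
    "\<And>y. y \<in> X \<Longrightarrow> \<exists>q. (\<forall>a\<in>A. q a = 0 \<or> q a = sgn (\<sigma> a)) \<and>
       (\<forall>z. net t h A q z = of_bool (z = x) - of_bool (z = y))"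
    "(\<Sum>y\<in>X. net t h A \<sigma> y) \<le> 0"
    "(\<Sum>y\<in>X. net t h A \<sigma> y) = 0 \<Longrightarrow> \<forall>a\<in>A. \<sigma> a \<noteq> 0 \<longrightarrow> (t a \<in> X \<longleftrightarrow> h a \<in> X)"
proof -
  define good where "good X \<longleftrightarrow> x \<in> X \<and> X \<subseteq> V \<and> (\<forall>y\<in>X. \<exists>q.
      (\<forall>a\<in>A. q a = 0 \<or> q a = sgn (\<sigma> a) \<and> t a \<in> X \<and> h a \<in> X) \<and>
      (\<forall>z. net t h A q z = of_bool (z = x) - of_bool (z = y)))" for X
  have "good {x}"
    unfolding good_def using x by (auto intro!: exI[of _ "\<lambda>_. 0"] simp: net_def)
  moreover have "finite {X. good X}"
    by (rule finite_subset[of _ "Pow V"]) (auto simp: good_def V)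
  ultimately obtain X where X: "good X" and max: "\<And>Y. good Y \<Longrightarrow> X \<subseteq> Y \<Longrightarrow> Y = X"
    using finite_has_maximal[of "{X. good X}"] by blast
  have extend: "y \<in> X" if a: "a \<in> A" and s: "\<sigma> a \<noteq> 0" and z: "z \<in> X" and
    ends: "\<sigma> a > 0 \<and> t a = z \<and> h a = y \<or> \<sigma> a < 0 \<and> h a = z \<and> t a = y" for a z y
  proof (rule ccontr)
    assume y: "y \<notin> X"
    obtain p where p: "\<And>a. a \<in> A \<Longrightarrow> p a = 0 \<or> p a = sgn (\<sigma> a) \<and> t a \<in> X \<and> h a \<in> X"
      "\<And>w. net t h A p w = of_bool (w = x) - of_bool (w = z)"
      using X z unfolding good_def by blast
    have pa: "p a = 0" using p(1)[OF a] ends y by auto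
    \<comment> \<open>Prolong the path from \<open>x\<close> to \<open>z\<close> by the edge \<open>a\<close> from \<open>z\<close> to \<open>y\<close>.\<close>
    define q where "q = p(a := sgn (\<sigma> a))"
    have A_eq: "A = insert a (A - {a})" using a by auto
    have net_q: "net t h A q w = of_bool (w = x) - of_bool (w = y)" for w
    proof -
      have "net t h (A - {a}) q w = net t h (A - {a}) p w"
        by (rule net_cong) (auto simp: q_def)
      moreover have "net t h A f w = (if t a = w then f a else 0) - (if h a = w then f a else 0)
          + net t h (A - {a}) f w" for f :: "'e \<Rightarrow> int"
        by (subst A_eq, rule net_insert) (use A in auto)
      ultimately show ?thesis
        using p(2)[of w] ends pa y z by (auto simp: q_def)
    qed
    have "good (insert y X)"
      unfolding good_def
    proof (intro conjI ballI)
      show "x \<in> insert y X" "insert y X \<subseteq> V" using X a V ends by (auto simp: good_def)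
    next
      fix w assume w: "w \<in> insert y X"
      show "\<exists>q. (\<forall>a\<in>A. q a = 0 \<or> q a = sgn (\<sigma> a) \<and> t a \<in> insert y X \<and> h a \<in> insert y X) \<and>
        (\<forall>z. net t h A q z = of_bool (z = x) - of_bool (z = w))"
      proof (cases "w = y")
        case True
        show ?thesis
          by (rule exI[of _ q]) (use True net_q p(1) ends z in \<open>auto simp: q_def\<close>)
      next
        case False
        then show ?thesis using w X unfolding good_def by blast
      qed
    qed
    from max[OF this] y show False by auto
  qed
  have term_le: "(if t a \<in> X then \<sigma> a else 0) - (if h a \<in> X then \<sigma> a else 0) \<le> 0" if "a \<in> A" for a
  proof -
    have "\<sigma> a > 0 \<longrightarrow> t a \<in> X \<longrightarrow> h a \<in> X"
      using extend[OF that, of "t a" "h a"] by auto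
    moreover have "\<sigma> a < 0 \<longrightarrow> h a \<in> X \<longrightarrow> t a \<in> X"
      using extend[OF that, of "h a" "t a"] by auto
    ultimately show ?thesis by (cases "t a \<in> X"; cases "h a \<in> X") auto
  qed
  have fX: "finite X" using X V finite_subset by (auto simp: good_def)
  show thesis
  proof (rule that[of X])
    show "x \<in> X" "X \<subseteq> V" using X by (auto simp: good_def)
    show "\<exists>q. (\<forall>a\<in>A. q a = 0 \<or> q a = sgn (\<sigma> a)) \<and>
       (\<forall>z. net t h A q z = of_bool (z = x) - of_bool (z = y))" if "y \<in> X" for y
      using X that unfolding good_def by blast
    show "(\<Sum>y\<in>X. net t h A \<sigma> y) \<le> 0"
      unfolding sum_net[OF fX] by (rule sum_nonpos) (rule term_le)
    assume "(\<Sum>y\<in>X. net t h A \<sigma> y) = 0"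
    then have "(\<Sum>a\<in>A. - ((if t a \<in> X then \<sigma> a else 0) - (if h a \<in> X then \<sigma> a else 0))) = 0"
      unfolding sum_net[OF fX] sum_negf by simp
    then have "\<forall>a\<in>A. - ((if t a \<in> X then \<sigma> a else 0) - (if h a \<in> X then \<sigma> a else 0)) = 0"
      by (subst (asm) sum_nonneg_eq_0_iff) (use A term_le in auto)
    then show "\<forall>a\<in>A. \<sigma> a \<noteq> 0 \<longrightarrow> (t a \<in> X \<longleftrightarrow> h a \<in> X)" by (auto split: if_splits)
  qed
qed

text \<open>Take a signing that minimises the sum of the squared boundaries. If the boundary at some \<open>x\<close>
  were at least \<open>2\<close>, then the set reachable from \<open>x\<close> would contain a vertex \<open>y\<close> with negative
  boundary, since its total boundary is at most zero. Reversing a path from \<open>x\<close> to \<open>y\<close> lowers the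
  boundary at \<open>x\<close> by \<open>2\<close> and raises it at \<open>y\<close> by \<open>2\<close>, which decreases the sum of squares.
  At vertices of even degree the bound forces the boundary to vanish, so this contains the fact
  that even graphs have Eulerian orientations.\<close>

lemma balanced_signing:
  assumes A: "finite A"
  shows "\<exists>s :: 'e \<Rightarrow> int. (\<forall>a\<in>A. s a = 1 \<or> s a = -1) \<and> (\<forall>x. \<bar>net t h A s x\<bar> \<le> 1)"
proof -
  define V where "V = t ` A \<union> h ` A"
  have V: "finite V" "t ` A \<subseteq> V" "h ` A \<subseteq> V" using A by (auto simp: V_def)
  define m where "m s = (\<Sum>x\<in>V. (net t h A s x)\<^sup>2)" for s :: "'e \<Rightarrow> int"
  define sgns where "sgns = {s :: 'e \<Rightarrow> int. \<forall>a\<in>A. s a = 1 \<or> s a = -1}"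
  have "(\<lambda>_. 1) \<in> sgns" by (simp add: sgns_def)
  then obtain s where s: "s \<in> sgns" and min': "\<And>r. r \<in> sgns \<Longrightarrow> nat (m s) \<le> nat (m r)"
    using ex_has_least_nat[of "\<lambda>s. s \<in> sgns" _ "\<lambda>s. nat (m s)"] by blast
  have m_nonneg: "m r \<ge> 0" for r unfolding m_def by (rule sum_nonneg) simp
  have min: "m s \<le> m r" if "r \<in> sgns" for r using min'[OF that] m_nonneg[of r] m_nonneg[of s] by simp
  have bound: "net t h A r x \<le> 1" if r: "r \<in> sgns" and mr: "m r = m s" for r x
  proof (rule ccontr)
    assume big: "\<not> net t h A r x \<le> 1"
    have x: "x \<in> V"
    proof (rule ccontr)
      assume "x \<notin> V"
      then have "net t h A r x = 0" by (intro net_outside) (auto simp: V_def)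
      with big show False by simp
    qed
    obtain X where X: "x \<in> X" "X \<subseteq> V"
      "\<And>y. y \<in> X \<Longrightarrow> \<exists>q. (\<forall>a\<in>A. q a = 0 \<or> q a = sgn (r a)) \<and>
         (\<forall>z. net t h A q z = of_bool (z = x) - of_bool (z = y))"
      "(\<Sum>y\<in>X. net t h A r y) \<le> 0"
      using augmenting_set[OF A V x, of r] by metis
    have fX: "finite X" using X V finite_subset by auto
    have "\<exists>y\<in>X. net t h A r y < 0"
    proof (rule ccontr)
      assume "\<not> ?thesis"
      then have nn: "\<And>y. y \<in> X \<Longrightarrow> 0 \<le> net t h A r y" by (auto simp: not_less)
      have "net t h A r x \<le> (\<Sum>y\<in>X. net t h A r y)"
        by (rule member_le_sum) (use nn X fX in auto)
      with X(4) big show False by simp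
    qed
    then obtain y where y: "y \<in> X" "net t h A r y < 0" by blast
    then have xy: "x \<noteq> y" "y \<in> V" using big X by auto
    obtain q where q: "\<And>a. a \<in> A \<Longrightarrow> q a = 0 \<or> q a = sgn (r a)"
      "\<And>z. net t h A q z = of_bool (z = x) - of_bool (z = y)"
      using X(3)[OF y(1)] by blast
    \<comment> \<open>Adding \<open>-2 * sgn (r a)\<close> to a sign \<open>r a\<close> reverses it.\<close>
    define r' where "r' a = r a + (-2) * q a" for a
    have "r' \<in> sgns"
      unfolding sgns_def mem_Collect_eq
    proof
      fix a assume a: "a \<in> A"
      then have "r a = 1 \<or> r a = -1" using r by (simp add: sgns_def)
      with q(1)[OF a] show "r' a = 1 \<or> r' a = -1" by (auto simp: r'_def)
    qed
    then have le: "m r \<le> m r'" using min mr by simp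
    have net_r': "net t h A r' z = net t h A r z - 2 * (of_bool (z = x) - of_bool (z = y))" for z
      unfolding r'_def net_add net_scale_int q(2) by simp
    have split: "m k = (net t h A k x)\<^sup>2 + (net t h A k y)\<^sup>2
        + (\<Sum>z\<in>V - {x, y}. (net t h A k z)\<^sup>2)" for k
    proof -
      have "m k = (\<Sum>z\<in>V - {x, y}. (net t h A k z)\<^sup>2) + (\<Sum>z\<in>{x, y}. (net t h A k z)\<^sup>2)"
        unfolding m_def by (rule sum.subset_diff) (use x xy V in auto)
      then show ?thesis using xy by simp
    qed
    have "(\<Sum>z\<in>V - {x, y}. (net t h A r' z)\<^sup>2) = (\<Sum>z\<in>V - {x, y}. (net t h A r z)\<^sup>2)"
      by (rule sum.cong) (auto simp: net_r')
    then have "m r' - m r = 4 * (1 - net t h A r x) + 4 * (net t h A r y + 1)"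
      using xy by (simp add: split net_r' power2_eq_square algebra_simps)
    with le big y show False by simp
  qed
  \<comment> \<open>The lower bound is the upper bound for the reversed signing, which is minimal as well.\<close>
  have ms: "m (\<lambda>a. - s a) = m s" by (simp add: m_def net_uminus)
  have "(\<lambda>a. - s a) \<in> sgns" using s by (auto simp: sgns_def)
  from bound[OF this ms] have "- net t h A s x \<le> 1" for x by (simp add: net_uminus)
  with bound[OF s refl] have "\<bar>net t h A s x\<bar> \<le> 1" for x by (smt (verit))
  then show ?thesis using s unfolding sgns_def by blast
qed

section \<open>Sending a value from one vertex to another\<close>

text \<open>With \<open>w = 0\<close> this is an \<open>\<Omega>\<close>-flow. The conditions range over all elements of the vertex type;
  at points that meet no edge of \<open>A\<close> the boundary is zero anyway.\<close>

definition transfers ::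
  "'a::ab_group_add set \<Rightarrow> ('e \<Rightarrow> 'v) \<Rightarrow> ('e \<Rightarrow> 'v) \<Rightarrow> 'v \<Rightarrow> 'v \<Rightarrow> 'e set \<Rightarrow> 'a \<Rightarrow> bool" where
  "transfers \<Omega> t h u v A w \<longleftrightarrow> (\<exists>f. (\<forall>a\<in>A. f a \<in> \<Omega>) \<and>
     (\<forall>x. net t h A f x = (if x = u then w else 0) - (if x = v then w else 0)))"

lemma transfersI:
  assumes "\<And>a. a \<in> A \<Longrightarrow> f a \<in> \<Omega>"
    and "\<And>x. net t h A f x = (if x = u then w else 0) - (if x = v then w else 0)"
  shows "transfers \<Omega> t h u v A w"
  using assms unfolding transfers_def by blast

lemma transfersE:
  assumes "transfers \<Omega> t h u v A w"
  obtains f where "\<And>a. a \<in> A \<Longrightarrow> f a \<in> \<Omega>"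
    and "\<And>x. net t h A f x = (if x = u then w else 0) - (if x = v then w else 0)"
  using assms unfolding transfers_def by blast

lemma transfers_0_iff:
  "transfers \<Omega> t h u v A 0 \<longleftrightarrow> (\<exists>f. (\<forall>a\<in>A. f a \<in> \<Omega>) \<and> (\<forall>x. net t h A f x = 0))"
  by (simp add: transfers_def)

lemma transfers_additive:
  assumes "transfers \<Omega> t h u v A w" and L: "Modules.additive L" and "\<And>y. y \<in> \<Omega> \<Longrightarrow> L y \<in> \<Omega>'"
  shows "transfers \<Omega>' t h u v A (L w)"
proof -
  interpret Modules.additive L by fact
  obtain f where f: "\<And>a. a \<in> A \<Longrightarrow> f a \<in> \<Omega>"
    "\<And>x. net t h A f x = (if x = u then w else 0) - (if x = v then w else 0)"
    using assms(1) by (rule transfersE) blast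
  show ?thesis
    by (rule transfersI[where f = "\<lambda>a. L (f a)"])
      (auto simp: net_additive[OF L] f assms(3) zero diff minus)
qed

lemma transfers_union:
  assumes "transfers \<Omega> t h u v A w" "transfers \<Omega> t h u v B w'"
    and fin: "finite A" "finite B" "A \<inter> B = {}"
  shows "transfers \<Omega> t h u v (A \<union> B) (w + w')"
proof -
  obtain f where f: "\<And>a. a \<in> A \<Longrightarrow> f a \<in> \<Omega>"
    "\<And>x. net t h A f x = (if x = u then w else 0) - (if x = v then w else 0)"
    using assms(1) by (rule transfersE) blast
  obtain g where g: "\<And>a. a \<in> B \<Longrightarrow> g a \<in> \<Omega>"
    "\<And>x. net t h B g x = (if x = u then w' else 0) - (if x = v then w' else 0)"
    using assms(2) by (rule transfersE) blast
  define k where "k a = (if a \<in> A then f a else g a)" for a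
  have "net t h (A \<union> B) k x = net t h A f x + net t h B g x" for x
    unfolding net_union[OF fin]
    by (rule arg_cong2[where f = "(+)"]; rule net_cong) (use fin in \<open>auto simp: k_def\<close>)
  then show ?thesis
    by (intro transfersI[where f = k]) (auto simp: k_def f g)
qed

section \<open>Changing a nowhere-zero 3-flow along a path\<close>

abbreviation nz3 :: "int set" where "nz3 \<equiv> {1, -1, 2, -2}"

text \<open>Subtracting \<open>3\<close> in the direction of positive flow turns \<open>1, 2\<close> into \<open>-2, -1\<close>, so the
  values stay nowhere zero. The second alternative for \<open>c\<close> says that \<open>u\<close> and \<open>v\<close> are in the same
  component of the edge set \<open>A\<close>; it is phrased through sets that are unions of components. If
  \<open>v\<close> were not reachable from \<open>u\<close>, the set of reachable vertices would have total boundary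
  \<open>c\<close>, which \<open>augmenting_set\<close> excludes for \<open>c > 0\<close> and which for \<open>c = 0\<close> means that no edge
  leaves the set.\<close>

lemma nz3_shift:
  assumes A: "finite A" and tr: "transfers nz3 t h u v A c" and uv: "u \<noteq> v"
    and c: "c > 0 \<or> c = 0 \<and> (\<forall>X. u \<in> X \<longrightarrow> (\<forall>a\<in>A. t a \<in> X \<longleftrightarrow> h a \<in> X) \<longrightarrow> v \<in> X)"
  shows "transfers nz3 t h u v A (c - 3)"
proof -
  obtain f where f: "\<And>a. a \<in> A \<Longrightarrow> f a \<in> nz3"
    "\<And>x. net t h A f x = (if x = u then c else 0) - (if x = v then c else 0)"
    using tr by (rule transfersE) blast
  have V: "finite (insert u (t ` A \<union> h ` A))" using A by simp
  obtain X where X: "u \<in> X" "X \<subseteq> insert u (t ` A \<union> h ` A)"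
    "\<And>y. y \<in> X \<Longrightarrow> \<exists>q. (\<forall>a\<in>A. q a = 0 \<or> q a = sgn (f a)) \<and>
       (\<forall>z. net t h A q z = of_bool (z = u) - of_bool (z = y))"
    "(\<Sum>y\<in>X. net t h A f y) \<le> 0"
    "(\<Sum>y\<in>X. net t h A f y) = 0 \<Longrightarrow> \<forall>a\<in>A. f a \<noteq> 0 \<longrightarrow> (t a \<in> X \<longleftrightarrow> h a \<in> X)"
    by (rule augmenting_set[OF A V, of t h u f]) auto
  have fX: "finite X" using X V finite_subset by blast
  have "v \<in> X"
  proof (rule ccontr)
    assume v: "v \<notin> X"
    then have "(\<Sum>y\<in>X. net t h A f y) = (\<Sum>y\<in>X. if y = u then c else 0)"
      by (intro sum.cong) (auto simp: f(2))
    also have "\<dots> = c" using fX X(1) by simp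
    finally have sum: "(\<Sum>y\<in>X. net t h A f y) = c" .
    with X(4) c have c0: "c = 0" "\<And>X. u \<in> X \<Longrightarrow> (\<forall>a\<in>A. t a \<in> X \<longleftrightarrow> h a \<in> X) \<Longrightarrow> v \<in> X" by auto
    moreover have "f a \<noteq> 0" if "a \<in> A" for a using f(1)[OF that] by auto
    ultimately show False using X(1,5) sum v by blast
  qed
  then obtain q where q: "\<And>a. a \<in> A \<Longrightarrow> q a = 0 \<or> q a = sgn (f a)"
    "\<And>z. net t h A q z = of_bool (z = u) - of_bool (z = v)"
    using X(3) by blast
  show ?thesis
  proof (rule transfersI[where f = "\<lambda>a. f a + (-3) * q a"])
    fix a assume a: "a \<in> A"
    show "f a + (-3) * q a \<in> nz3" using f(1)[OF a] q(1)[OF a] by auto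
  next
    fix x
    show "net t h A (\<lambda>a. f a + (-3) * q a) x
      = (if x = u then c - 3 else 0) - (if x = v then c - 3 else 0)"
      unfolding net_add net_scale_int f(2) q(2) using uv by auto
  qed
qed

lemma nz3_uminus: "transfers nz3 t h u v A c \<Longrightarrow> transfers nz3 t h u v A (- c)"
  by (rule transfers_additive) (auto simp: Modules.additive_def)

text \<open>By symmetry assume \<open>c > 0\<close>; as long as \<open>c \<ge> 2\<close>, the shift to \<open>c - 3\<close> decreases the absolute
  value.\<close>

lemma nz3_reduce:
  assumes A: "finite A" and uv: "u \<noteq> v" and "transfers nz3 t h u v A c"
  shows "transfers nz3 t h u v A 0 \<or> transfers nz3 t h u v A 1"
  using assms(3)
proof (induction "nat \<bar>c\<bar>" arbitrary: c rule: less_induct)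
  case less
  have pos: "transfers nz3 t h u v A \<bar>c\<bar>"
    using less.prems nz3_uminus[OF less.prems] by (cases "c \<ge> 0") auto
  show ?case
  proof (cases "\<bar>c\<bar> \<le> 1")
    case True
    then have "\<bar>c\<bar> = 0 \<or> \<bar>c\<bar> = 1" by linarith
    then show ?thesis using pos by metis
  next
    case False
    have "transfers nz3 t h u v A (\<bar>c\<bar> - 3)"
      by (rule nz3_shift[OF A pos uv]) (use False in auto)
    then show ?thesis by (rule less.hyps[rotated]) (use False in auto)
  qed
qed

section \<open>Unit vectors from a nowhere-zero 3-flow\<close>

abbreviation S1 :: "(real^2) set" where "S1 \<equiv> {x. norm x = 1}"

lemma norm_vector_2: "norm (vector [a, b] :: real^2) = sqrt (a\<^sup>2 + b\<^sup>2)"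
  by (simp add: norm_vec_def L2_set_def sum_2)

text \<open>The first coordinate is half of the flow, so edges of value \<open>\<plusminus>2\<close> already have length \<open>1\<close>. On
  the edges of value \<open>\<plusminus>1\<close> the second coordinate must be \<open>\<plusminus>\<surd>3 / 2\<close>, and a balanced signing of these
  edges supplies the signs. The case \<open>c = 0\<close> contains the known fact that a nowhere-zero \<open>3\<close>-flow
  gives an \<open>S\<^sup>1\<close>-flow.\<close>

lemma S1_of_nz3:
  assumes A: "finite A" and uv: "u \<noteq> v" and tr: "transfers nz3 t h u v A c"
  obtains b :: int where "b \<in> {0, 1, -1}" "even b \<longleftrightarrow> even c"
    "transfers S1 t h u v A (vector [of_int c / 2, sqrt 3 / 2 * of_int b])"
proof -
  obtain f where f: "\<And>a. a \<in> A \<Longrightarrow> f a \<in> nz3"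
    "\<And>x. net t h A f x = (if x = u then c else 0) - (if x = v then c else 0)"
    using tr by (rule transfersE) blast
  define B where "B = {a\<in>A. odd (f a)}"
  have fB: "finite B" using A by (simp add: B_def)
  obtain s' :: "'a \<Rightarrow> int" where
    s': "\<And>a. a \<in> B \<Longrightarrow> s' a = 1 \<or> s' a = -1" "\<And>x. \<bar>net t h B s' x\<bar> \<le> 1"
    using balanced_signing[OF fB, of t h] by blast
  define s where "s a = (if a \<in> B then s' a else 0)" for a
  have net_s: "net t h A s x = net t h B s' x" for x
    unfolding net_def using A by (intro sum.mono_neutral_cong_right) (auto simp: B_def s_def)
  have par: "even (net t h A s x) \<longleftrightarrow> even (net t h A f x)" for x
    by (rule even_net_cong) (use s'(1) in \<open>force simp: s_def B_def\<close>)
  have s_le: "\<bar>net t h A s x\<bar> \<le> 1" for x using s'(2) net_s by simp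
  define b where "b = net t h A s u"
  have zero: "net t h A s x = 0" if "x \<noteq> u" "x \<noteq> v" for x
  proof -
    have "even (net t h A s x)" using par[of x] f(2)[of x] that by simp
    with s_le[of x] show ?thesis by (smt (verit) odd_one even_minus)
  qed
  have "b + net t h A s v = 0"
  proof -
    define V where "V = insert u (insert v (t ` A \<union> h ` A))"
    have fV: "finite V" using A by (simp add: V_def)
    have "(\<Sum>x\<in>V. net t h A s x) = (\<Sum>x\<in>{u, v}. net t h A s x)"
      by (rule sum.mono_neutral_right) (use fV zero in \<open>auto simp: V_def\<close>)
    moreover have "(\<Sum>x\<in>V. net t h A s x) = 0"
      by (rule sum_net_eq_0[OF fV]) (auto simp: V_def)
    ultimately show ?thesis using uv by (simp add: b_def)
  qed
  then have net_b: "net t h A s x = (if x = u then b else 0) - (if x = v then b else 0)" for x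
    using zero[of x] uv by (auto simp: b_def)
  define F :: "'a \<Rightarrow> real^2" where "F a = vector [of_int (f a) / 2, sqrt 3 / 2 * of_int (s a)]" for a
  \<comment> \<open>Written in the standard basis, additivity of both coordinates becomes usable.\<close>
  have vec_eq: "vector [of_int i / 2, sqrt 3 / 2 * of_int j]
      = (of_int i / 2) *\<^sub>R axis 1 1 + (sqrt 3 / 2 * of_int j) *\<^sub>R (axis 2 1 :: real^2)" for i j :: int
    by (simp add: vec_eq_iff forall_2 axis_def)
  have F_eq: "F = (\<lambda>a. (of_int (f a) / 2) *\<^sub>R axis 1 1 + (sqrt 3 / 2 * of_int (s a)) *\<^sub>R axis 2 1)"
    unfolding F_def vec_eq ..
  have ad: "Modules.additive (\<lambda>i::int. (of_int i / 2) *\<^sub>R (axis 1 1 :: real^2))"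
    "Modules.additive (\<lambda>i::int. (sqrt 3 / 2 * of_int i) *\<^sub>R (axis 2 1 :: real^2))"
    by (auto simp: Modules.additive_def algebra_simps add_divide_distrib)
  have net_F: "net t h A F x = vector [of_int (net t h A f x) / 2, sqrt 3 / 2 * of_int (net t h A s x)]" for x
    unfolding F_eq net_add net_additive[OF ad(1), of t h A f] net_additive[OF ad(2), of t h A s] vec_eq ..
  have "transfers S1 t h u v A (vector [of_int c / 2, sqrt 3 / 2 * of_int b])"
  proof (rule transfersI[where f = F])
    fix a assume a: "a \<in> A"
    have "norm (F a) = sqrt ((of_int (f a))\<^sup>2 / 4 + 3 / 4 * (of_int (s a))\<^sup>2)"
      by (simp add: F_def norm_vector_2 power_mult_distrib power_divide)
    moreover have "(s a)\<^sup>2 = (if odd (f a) then 1 else 0)"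
      using a s'(1)[of a] by (auto simp: s_def B_def)
    then have "(of_int (s a))\<^sup>2 = (if odd (f a) then 1 else 0 :: real)"
      by (metis of_int_power of_int_1 of_int_0)
    ultimately show "F a \<in> S1" using f(1)[OF a] by auto
  next
    fix x
    show "net t h A F x = (if x = u then vector [of_int c / 2, sqrt 3 / 2 * of_int b] else 0)
        - (if x = v then vector [of_int c / 2, sqrt 3 / 2 * of_int b] else 0)"
      unfolding net_F f(2) net_b by (auto simp: vec_eq_iff forall_2)
  qed
  moreover have "b \<in> {0, 1, -1}" using s_le[of u] by (auto simp: b_def)
  moreover have "even b \<longleftrightarrow> even c" using par[of u] f(2)[of u] uv by (simp add: b_def)
  ultimately show thesis using that by blast
qed

section \<open>Lengths that an edge set can carry\<close>

definition carries ::
  "('e \<Rightarrow> 'v) \<Rightarrow> ('e \<Rightarrow> 'v) \<Rightarrow> 'v \<Rightarrow> 'v \<Rightarrow> 'e set \<Rightarrow> real \<Rightarrow> bool" where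
  "carries t h u v A r \<longleftrightarrow> (\<exists>w. norm w = r \<and> transfers S1 t h u v A w)"

text \<open>Any two vectors of equal length are related by an orthogonal map, which can be applied to the
  values on all edges at once.\<close>

lemma carries_rotate:
  assumes "carries t h u v A r" "norm w = r"
  shows "transfers S1 t h u v A w"
proof -
  obtain w' where w': "norm w' = r" "transfers S1 t h u v A w'"
    using assms(1) unfolding carries_def by blast
  obtain L where L: "orthogonal_transformation L" "L w' = w"
    using orthogonal_transformation_exists[of w' w] w'(1) assms(2) by metis
  then have "linear L" by (simp add: orthogonal_transformation_linear)
  then have "Modules.additive L" by (simp add: Modules.additive_def linear_add)
  then have "transfers S1 t h u v A (L w')"
    by (rule transfers_additive[OF w'(2)]) (use L in \<open>simp add: orthogonal_transformation_norm\<close>)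
  with L show ?thesis by simp
qed

lemma carries_0_iff: "carries t h u v A 0 \<longleftrightarrow> transfers S1 t h u v A 0"
  by (auto simp: carries_def)

lemma carries_union:
  fixes x y :: "real^2"
  assumes "carries t h u v A (norm x)" "carries t h u v B (norm y)"
    and "finite A" "finite B" "A \<inter> B = {}"
  shows "carries t h u v (A \<union> B) (norm (x + y))"
proof -
  have "transfers S1 t h u v (A \<union> B) (x + y)"
    by (rule transfers_union[OF carries_rotate[OF assms(1) refl] carries_rotate[OF assms(2) refl]])
      (rule assms)+
  then show ?thesis unfolding carries_def by blast
qed

lemma carries_union_cancel:
  assumes "carries t h u v A r" "carries t h u v B r" "r \<ge> 0"
    and "finite A" "finite B" "A \<inter> B = {}"
  shows "carries t h u v (A \<union> B) 0"
proof -
  define x :: "real^2" where "x = vector [r, 0]"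
  have "norm x = r" using assms(3) by (simp add: x_def norm_vector_2)
  then show ?thesis using carries_union[of t h u v A x B "- x"] assms by simp
qed

lemma carries_union_null:
  assumes "carries t h u v A 0" "carries t h u v B r" "r \<ge> 0"
    and "finite A" "finite B" "A \<inter> B = {}"
  shows "carries t h u v (A \<union> B) r"
proof -
  define x :: "real^2" where "x = vector [r, 0]"
  have "norm x = r" using assms(3) by (simp add: x_def norm_vector_2)
  then show ?thesis using carries_union[of t h u v A 0 B x] assms by simp
qed

text \<open>The vectors \<open>(1/2, k)\<close> and \<open>(1/2, - k)\<close> have length \<open>r\<close> and sum \<open>(1, 0)\<close>: an isosceles
  triangle with base \<open>1\<close>, which exists exactly for \<open>r \<ge> 1/2\<close>.\<close>

lemma carries_union_isosceles:
  assumes "carries t h u v A r" "carries t h u v B r" "r \<ge> 1 / 2"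
    and "finite A" "finite B" "A \<inter> B = {}"
  shows "carries t h u v (A \<union> B) 1"
proof -
  define k where "k = sqrt (r\<^sup>2 - 1 / 4)"
  have "r\<^sup>2 \<ge> (1 / 2)\<^sup>2" using assms(3) by (intro power_mono) auto
  then have k: "k\<^sup>2 = r\<^sup>2 - 1 / 4" by (simp add: k_def power_divide)
  define x y :: "real^2" where "x = vector [1 / 2, k]" and "y = vector [1 / 2, - k]"
  have "norm x = r" "norm y = r"
    using assms(3) by (simp_all add: x_def y_def norm_vector_2 k power_divide)
  moreover have "x + y = vector [1, 0]" by (simp add: x_def y_def vec_eq_iff forall_2)
  then have "norm (x + y) = 1" by (simp add: norm_vector_2)
  ultimately show ?thesis using carries_union[of t h u v A x B y] assms by simp
qed

lemma carries_edge:
  assumes "{t a, h a} = {u, v}"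
  shows "carries t h u v {a} 1"
proof -
  define x :: "real^2" where "x = vector [1, 0]"
  have x: "norm x = 1" by (simp add: x_def norm_vector_2)
  have "t a = u \<and> h a = v \<or> t a = v \<and> h a = u" using assms by (auto simp: doubleton_eq_iff)
  then have "transfers S1 t h u v {a} x"
  proof
    assume "t a = u \<and> h a = v"
    then show ?thesis
      using x by (intro transfersI[where f = "\<lambda>_. x"]) (auto simp: net_def)
  next
    assume "t a = v \<and> h a = u"
    then show ?thesis
      using x by (intro transfersI[where f = "\<lambda>_. - x"]) (auto simp: net_def)
  qed
  then show ?thesis using x unfolding carries_def by blast
qed

text \<open>The first parallel edge leads from \<open>0\<close> to \<open>1\<close>, and every further one keeps the length \<open>1\<close>,
  because two unit vectors can have a sum of length \<open>1\<close>.\<close>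

lemma carries_parallels:
  assumes "finite P" "P \<noteq> {}" "\<And>a. a \<in> P \<Longrightarrow> {t a, h a} = {u, v}"
    and A: "finite A" "carries t h u v A 0 \<or> carries t h u v A 1" and "A \<inter> P = {}"
  shows "carries t h u v (A \<union> P) 1"
  using assms(1,2,3,6)
proof (induction P rule: finite_ne_induct)
  case (singleton a)
  then have "carries t h u v {a} 1" by (intro carries_edge) simp
  then show ?case
    using A singleton carries_union_null[of t h u v A "{a}" 1]
      carries_union_isosceles[of t h u v A 1 "{a}"] by auto
next
  case (insert a P)
  have a: "carries t h u v {a} 1" by (rule carries_edge) (simp add: insert)
  have "carries t h u v (A \<union> P) 1" by (rule insert.IH) (use insert in auto)
  from carries_union_isosceles[OF this a] have "carries t h u v ((A \<union> P) \<union> {a}) 1"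
    using insert A by auto
  then show ?case by simp
qed

section \<open>Flows of graphs as transfers\<close>

lemma boundary_eq_net:
  assumes "finite (arcs D)"
  shows "boundary D f x = net (tail D) (head D) (arcs D) f x"
  unfolding boundary_def net_def sum_subtractf out_arcs_def in_arcs_def
  using assms by (simp add: sum.inter_filter)

text \<open>A flow comes with its own orientation; negating it on the edges that this orientation directs
  differently from \<open>t\<close> and \<open>h\<close> does not change the boundary. Loops, if there are any, contribute
  nothing to either side.\<close>

lemma reorient:
  fixes f :: "'e \<Rightarrow> 'a::euclidean_space"
  assumes "orientation H D" "finite (edges H)"
    and ends: "\<And>a. a \<in> edges H \<Longrightarrow> {t a, h a} = ends H a"
  obtains g where "\<And>a. g a = f a \<or> g a = - f a"
    "\<And>x. net t h (edges H) g x = boundary D f x"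
proof -
  have D: "arcs D = edges H" "\<And>a. a \<in> edges H \<Longrightarrow> {tail D a, head D a} = {t a, h a}"
    using assms by (auto simp: orientation_def)
  define g where "g a = (if tail D a = t a then f a else - f a)" for a
  have "net t h (edges H) g x = boundary D f x" for x
    unfolding boundary_eq_net[OF assms(2)[folded D(1)]] D(1) net_def
  proof (rule sum.cong[OF refl])
    fix a assume "a \<in> edges H"
    from D(2)[OF this]
    have "tail D a = t a \<and> head D a = h a \<or> tail D a = h a \<and> head D a = t a"
      by (auto simp: doubleton_eq_iff)
    then show "(if t a = x then g a else 0) - (if h a = x then g a else 0)
      = (if tail D a = x then f a else 0) - (if head D a = x then f a else 0)"
      by (auto simp: g_def)
  qed
  then show thesis by (intro that[of g]) (auto simp: g_def)
qed

lemma admits_S1_flow_iff_carries: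
  assumes fin: "finite (edges H)"
    and ends: "\<And>a. a \<in> edges H \<Longrightarrow> {t a, h a} = ends H a \<and> ends H a \<subseteq> vertices H"
  shows "admits_S1_flow H \<longleftrightarrow> carries t h u v (edges H) 0"
proof
  assume "admits_S1_flow H"
  then obtain D and f :: "'a \<Rightarrow> real^2" where D: "orientation H D"
    and f: "\<And>a. a \<in> edges H \<Longrightarrow> norm (f a) = 1" "\<And>x. x \<in> vertices H \<Longrightarrow> boundary D f x = 0"
    unfolding admits_S1_flow_def admits_flow_def omega_flow_def by blast
  obtain g where g: "\<And>a. g a = f a \<or> g a = - f a"
    "\<And>x. net t h (edges H) g x = boundary D f x"
    using reorient[OF D fin, of t h f] ends by metis
  have "net t h (edges H) g x = 0" for x
  proof (cases "x \<in> vertices H")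
    case True
    then show ?thesis using g f by simp
  next
    case False
    then show ?thesis by (intro net_outside) (use ends in blast)
  qed
  moreover have "norm (g a) = 1" if "a \<in> edges H" for a
    using g(1)[of a] f(1)[OF that] by auto
  ultimately have "transfers S1 t h u v (edges H) 0" by (intro transfersI[where f = g]) auto
  then show "carries t h u v (edges H) 0" by (simp add: carries_0_iff)
next
  assume "carries t h u v (edges H) 0"
  then obtain f where f: "\<And>a. a \<in> edges H \<Longrightarrow> f a \<in> S1" "\<And>x. net t h (edges H) f x = 0"
    unfolding carries_0_iff transfers_0_iff by blast
  define D where "D = \<lparr>verts = vertices H, arcs = edges H, tail = t, head = h\<rparr>"
  have "omega_flow {x :: real^2. norm x = 1} H D f"
    unfolding omega_flow_def orientation_def
    using ends f fin by (auto simp: D_def boundary_eq_net)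
  then show "admits_S1_flow H" unfolding admits_S1_flow_def admits_flow_def by blast
qed

text \<open>In an \<open>S\<^sup>1\<close>-flow, the edges other than \<open>e\<close> must return the unit vector that \<open>e\<close> sends.\<close>

lemma carries_delete_edge:
  assumes "finite A" "e \<in> A" "carries t h (t e) (h e) A 0"
  shows "carries t h (t e) (h e) (A - {e}) 1"
proof -
  obtain f where f: "\<And>a. a \<in> A \<Longrightarrow> f a \<in> S1" "\<And>x. net t h A f x = 0"
    using assms(3) unfolding carries_0_iff transfers_0_iff by blast
  have "net t h (A - {e}) f x = (if x = t e then - f e else 0) - (if x = h e then - f e else 0)" for x
  proof -
    have "net t h (insert e (A - {e})) f x = 0" using assms(2) f(2) by (simp add: insert_absorb)
    then have "net t h (A - {e}) f x
        = - ((if t e = x then f e else 0) - (if h e = x then f e else 0))"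
      using net_insert[of "A - {e}" e t h f x] assms(1)
      by (simp only: eq_neg_iff_add_eq_0 add.commute) simp
    then show ?thesis by auto
  qed
  then have "transfers S1 t h (t e) (h e) (A - {e}) (- f e)"
    using f by (intro transfersI[where f = f]) auto
  then show ?thesis
    using f(1)[OF assms(2)] unfolding carries_def by (intro exI[of _ "- f e"]) simp
qed

section \<open>Nowhere-zero 3-flows of a contraction\<close>

text \<open>Vertices other than the ends of \<open>e\<close> keep their incident edges under contraction, so the lifted
  flow is still balanced there; the boundaries of the two ends then cancel, because the boundaries
  of all vertices always sum to zero.\<close>

lemma nz3_of_contract:
  fixes H :: "('v, 'e) mgraph"
  assumes H: "multigraph H" and e: "e \<in> edges H"
    and ends: "\<And>a. a \<in> edges H \<Longrightarrow> {t a, h a} = ends H a"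
    and flow: "admits_nz3_flow (contract_edge H e)"
  obtains c where "transfers nz3 t h (t e) (h e) {a \<in> edges H. ends H a \<noteq> ends H e} c"
proof -
  interpret multigraph H by fact
  define K where "K = contract_edge H e"
  define A where "A = {a \<in> edges H. ends H a \<noteq> ends H e}"
  define cl where "cl = contract_class H e"
  have K: "vertices K = cl ` vertices H" "edges K = A" "\<And>a. ends K a = cl ` ends H a"
    by (simp_all add: K_def contract_edge_def A_def cl_def)
  have A: "finite A" "A \<subseteq> edges H" using finite_edges by (auto simp: A_def)
  obtain D and f :: "'e \<Rightarrow> real" where D: "orientation K D"
    and f: "\<And>a. a \<in> A \<Longrightarrow> f a \<in> {1, -1, 2, -2}" "\<And>x. x \<in> vertices K \<Longrightarrow> boundary D f x = 0"
    using flow unfolding admits_nz3_flow_def admits_flow_def omega_flow_def K_def[symmetric] K(2)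
    by blast
  have endsK: "{(cl \<circ> t) a, (cl \<circ> h) a} = ends K a" if "a \<in> edges K" for a
  proof -
    have "a \<in> edges H" using that A K(2) by auto
    then show ?thesis by (simp add: K(3) flip: ends)
  qed
  obtain g where g: "\<And>a. g a = f a \<or> g a = - f a"
    "\<And>x. net (cl \<circ> t) (cl \<circ> h) A g x = boundary D f x"
    using reorient[OF D _ endsK, of f] A(1) K(2) by metis
  \<comment> \<open>The values are integers, and the parity argument needs them as such.\<close>
  define k where "k a = \<lfloor>g a\<rfloor>" for a
  have gf: "g a \<in> {1, -1, 2, -2}" if "a \<in> A" for a using g(1)[of a] f(1)[OF that] by auto
  have m1: "\<lfloor>-1 :: real\<rfloor> = -1" by (simp add: floor_eq_iff)
  have gk: "g a = of_int (k a)" if "a \<in> A" for a using gf[OF that] by (auto simp: k_def m1)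
  have k: "k a \<in> nz3" if "a \<in> A" for a using gf[OF that] by (auto simp: k_def m1)
  have netk: "real_of_int (net t' h' A k x) = net t' h' A g x" for t' h' :: "'e \<Rightarrow> 'b" and x
  proof -
    have "net t' h' A g x = net t' h' A (\<lambda>a. real_of_int (k a)) x"
      by (rule net_cong) (rule gk)
    also have "\<dots> = of_int (net t' h' A k x)"
      by (rule net_additive) (simp add: Modules.additive_def)
    finally show ?thesis ..
  qed
  have te: "t e \<noteq> h e" using loopless[OF e] ends[OF e, symmetric] by auto
  have inV: "t a \<in> vertices H \<and> h a \<in> vertices H" if "a \<in> A" for a
    using ends[of a] ends_subset[of a] A that by blast
  have zero: "net t h A k x = 0" if x: "x \<noteq> t e" "x \<noteq> h e" for x
  proof (cases "x \<in> vertices H")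
    case False
    then show ?thesis by (intro net_outside) (use inV in blast)
  next
    case True
    have "cl y = {x} \<longleftrightarrow> y = x" for y
      using x te ends[OF e, symmetric] by (auto simp: cl_def contract_class_def)
    then have "net t h A g x = net (cl \<circ> t) (cl \<circ> h) A g {x}" by (simp add: net_def)
    also have "\<dots> = 0"
    proof -
      have "cl x = {x}" using x ends[OF e, symmetric] by (auto simp: cl_def contract_class_def)
      then have "{x} \<in> vertices K" using True K(1) by force
      then show ?thesis using f(2) g(2) by simp
    qed
    finally show ?thesis using netk[of t h x] by simp
  qed
  have "(\<Sum>x\<in>vertices H. net t h A k x) = (\<Sum>x\<in>{t e, h e}. net t h A k x)"
    by (rule sum.mono_neutral_right)
      (use finite_vertices ends[OF e] ends_subset[OF e] zero in auto)
  moreover have "(\<Sum>x\<in>vertices H. net t h A k x) = 0"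
    by (rule sum_net_eq_0[OF finite_vertices]) (use inV in auto)
  ultimately have "net t h A k (h e) = - net t h A k (t e)" using te by simp
  then have "transfers nz3 t h (t e) (h e) A (net t h A k (t e))"
    using k zero te by (intro transfersI[where f = k]) auto
  then show thesis unfolding A_def by (rule that)
qed

text \<open>The boundary vector is \<open>(c / 2, b \<surd>3 / 2)\<close> with \<open>b\<close> of the parity of \<open>c\<close>; its squared length
  \<open>(c\<^sup>2 + 3 b\<^sup>2) / 4\<close> is \<open>0\<close>, \<open>1\<close>, \<open>3\<close> for \<open>|c| = 0, 1, 3\<close>.\<close>

lemma carries_of_nz3:
  assumes A: "finite A" and uv: "u \<noteq> v" and tr: "transfers nz3 t h u v A c"
  shows "c = 0 \<Longrightarrow> carries t h u v A 0" "\<bar>c\<bar> = 1 \<Longrightarrow> carries t h u v A 1"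
    "\<bar>c\<bar> = 3 \<Longrightarrow> carries t h u v A (sqrt 3)"
proof -
  obtain b :: int where b: "b \<in> {0, 1, -1}" "even b \<longleftrightarrow> even c" and
    tr': "transfers S1 t h u v A (vector [of_int c / 2, sqrt 3 / 2 * of_int b])"
    by (rule S1_of_nz3[OF A uv tr])
  have carr: "carries t h u v A (sqrt ((of_int c)\<^sup>2 / 4 + 3 / 4 * (of_int b)\<^sup>2))"
    unfolding carries_def
    by (rule exI, rule conjI[OF _ tr'])
      (simp add: norm_vector_2 power_mult_distrib power_divide)
  show "carries t h u v A 0" if "c = 0"
    using carr b that by auto
  show "carries t h u v A 1" if "\<bar>c\<bar> = 1"
  proof -
    have "c = 1 \<or> c = -1" using that by linarith
    then show ?thesis using carr b by auto
  qed
  show "carries t h u v A (sqrt 3)" if "\<bar>c\<bar> = 3"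
  proof -
    have "c = 3 \<or> c = -3" using that by linarith
    then show ?thesis using carr b by auto
  qed
qed

lemma linked_closed:
  assumes "linked H u v" "u \<in> X"
    and ends: "\<And>a. a \<in> edges H \<Longrightarrow> {t a, h a} = ends H a \<and> (t a \<in> X \<longleftrightarrow> h a \<in> X)"
  shows "v \<in> X"
  using assms(1) unfolding linked_def
proof (induction rule: rtrancl_induct)
  case base
  show ?case by fact
next
  case (step y z)
  then obtain a where "a \<in> edges H" "ends H a = {y, z}" by blast
  then show ?case using ends[of a] step.IH by (auto simp: doubleton_eq_iff)
qed

text \<open>The contraction also removes the edges \<open>P\<close> parallel to \<open>e\<close>, which have to be put back. If there
  are any, they adjust the length to \<open>1\<close>. If there are none and \<open>A\<close> does not carry \<open>1\<close>, then the
  \<open>3\<close>-flow can be chosen with boundary \<open>0\<close> at the ends of \<open>e\<close>; if moreover \<open>e\<close> is not a bridge, its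
  ends are connected in \<open>A\<close>, and a shift to boundary \<open>-3\<close> gives the length \<open>\<surd>3\<close>.\<close>

lemma carries_of_contract:
  fixes H :: "('v, 'e) mgraph"
  assumes H: "multigraph H" and e: "e \<in> edges H"
    and ends: "\<And>a. a \<in> edges H \<Longrightarrow> {t a, h a} = ends H a"
    and flow: "admits_nz3_flow (contract_edge H e)"
  defines "B \<equiv> edges H - {e}"
  shows "carries t h (t e) (h e) B 0 \<or> carries t h (t e) (h e) B 1" (is ?weak)
    and "\<not> bridge H e \<Longrightarrow> carries t h (t e) (h e) B 1 \<or>
      carries t h (t e) (h e) B 0 \<and> carries t h (t e) (h e) B (sqrt 3)" (is "_ \<Longrightarrow> ?strong")
proof -
  interpret multigraph H by fact
  define A where "A = {a \<in> edges H. ends H a \<noteq> ends H e}"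
  define P where "P = {a \<in> edges H. ends H a = ends H e} - {e}"
  let ?u = "t e" and ?v = "h e"
  have B: "B = A \<union> P" and fin: "finite A" "finite P" and disj: "A \<inter> P = {}"
    using finite_edges by (auto simp: A_def P_def B_def)
  have uv: "?u \<noteq> ?v" using loopless[OF e] ends[OF e, symmetric] by auto
  obtain c where "transfers nz3 t h ?u ?v A c"
    using nz3_of_contract[OF H e ends flow] unfolding A_def by blast
  from nz3_reduce[OF fin(1) uv this]
  have red: "transfers nz3 t h ?u ?v A 0 \<or> transfers nz3 t h ?u ?v A 1" .
  then have carrA: "carries t h ?u ?v A 0 \<or> carries t h ?u ?v A 1"
    using carries_of_nz3[OF fin(1) uv] by fastforce
  have par: "carries t h ?u ?v B 1" if "P \<noteq> {}"
    unfolding B by (rule carries_parallels[OF fin(2) that _ fin(1) carrA disj])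
      (use ends ends[OF e] in \<open>auto simp: P_def\<close>)
  show ?weak using par carrA B by (cases "P = {}") auto
  show ?strong if nb: "\<not> bridge H e"
  proof (cases "P \<noteq> {} \<or> carries t h ?u ?v A 1")
    case True
    then show ?thesis using par B by (cases "P = {}") auto
  next
    case False
    then have BA: "B = A" and no1: "\<not> carries t h ?u ?v A 1" using B by auto
    with red carries_of_nz3(2)[OF fin(1) uv, of t h 1]
    have tr0: "transfers nz3 t h ?u ?v A 0" by auto
    have link: "linked (delete_edge H e) ?u ?v"
      using nb e ends[OF e] unfolding bridge_def by metis
    have "transfers nz3 t h ?u ?v A (0 - 3)"
    proof (rule nz3_shift[OF fin(1) tr0 uv], intro disjI2 conjI allI impI)
      fix X assume X: "?u \<in> X" "\<forall>a\<in>A. (t a \<in> X) = (h a \<in> X)"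
      show "?v \<in> X"
        by (rule linked_closed[OF link X(1), of t h])
          (use ends X(2) BA in \<open>auto simp: delete_edge_def B_def\<close>)
    qed simp
    then have "carries t h ?u ?v A (sqrt 3)" using carries_of_nz3(3)[OF fin(1) uv] by fastforce
    moreover have "carries t h ?u ?v A 0" using carrA no1 by blast
    ultimately show ?thesis using BA by simp
  qed
qed

section \<open>Flows of a 2-sum\<close>

theorem theorem3p5:
  fixes G G1 G2 :: "('v, 'e) mgraph" and e :: 'e
  assumes "multigraph G" and "multigraph G1" and "multigraph G2"
    and "two_sum G e G1 G2"
  shows "(admits_S1_flow G1 \<and> admits_S1_flow G2 \<longrightarrow>
            admits_S1_flow G \<and> admits_S1_flow (delete_edge G e)) \<and>
         (admits_nz3_flow (contract_edge G1 e) \<and> admits_S1_flow G2 \<longrightarrow>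
            admits_S1_flow G) \<and>
         (admits_S1_flow G1 \<and> admits_S1_flow (delete_edge G2 e) \<longrightarrow>
            admits_S1_flow G) \<and>
         (bridgeless G1 \<and> bridgeless G2 \<and>
          admits_nz3_flow (contract_edge G1 e) \<and> admits_nz3_flow (contract_edge G2 e) \<longrightarrow>
            admits_S1_flow G)"
proof -
  interpret G: multigraph G by fact
  interpret G1: multigraph G1 by fact
  interpret G2: multigraph G2 by fact
  have E: "edges G = edges G1 \<union> edges G2" "edges G1 \<inter> edges G2 = {e}"
    and ends1: "\<And>a. a \<in> edges G1 \<Longrightarrow> ends G a = ends G1 a"
    and ends2: "\<And>a. a \<in> edges G2 \<Longrightarrow> ends G a = ends G2 a"
    using assms(4) by (auto simp: two_sum_def)
  have e: "e \<in> edges G1" "e \<in> edges G2" using E(2) by auto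
  have "\<forall>a. \<exists>x y. a \<in> edges G \<longrightarrow> {x, y} = ends G a"
    using G.loopless by (metis card_2_iff)
  then obtain t h where th: "\<And>a. a \<in> edges G \<Longrightarrow> {t a, h a} = ends G a" by metis
  have th1: "{t a, h a} = ends G1 a" if "a \<in> edges G1" for a using th[of a] ends1 E that by auto
  have th2: "{t a, h a} = ends G2 a" if "a \<in> edges G2" for a using th[of a] ends2 E that by auto
  let ?c = "carries t h (t e) (h e)"
  define A where "A = edges G1 - {e}"
  define B where "B = edges G2 - {e}"
  have fin: "finite A" "finite B" "A \<inter> B = {}" and finAB: "finite (A \<union> B)" "(A \<union> B) \<inter> {e} = {}"
    and del: "edges G - {e} = A \<union> B" and all: "edges G = (A \<union> B) \<union> {e}"
    using E G1.finite_edges G2.finite_edges by (auto simp: A_def B_def)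
  have G: "admits_S1_flow G \<longleftrightarrow> ?c (edges G) 0"
    by (rule admits_S1_flow_iff_carries) (use G.finite_edges th G.ends_subset in auto)
  have Ge: "admits_S1_flow (delete_edge G e) \<longleftrightarrow> ?c (A \<union> B) 0"
  proof -
    have "edges (delete_edge G e) = A \<union> B" using del by (simp add: delete_edge_def)
    then show ?thesis
      using admits_S1_flow_iff_carries[of "delete_edge G e" t h "t e" "h e"] finAB(1) th all
        G.ends_subset by (auto simp: delete_edge_def)
  qed
  have G2e: "admits_S1_flow (delete_edge G2 e) \<longleftrightarrow> ?c B 0"
    using admits_S1_flow_iff_carries[of "delete_edge G2 e" t h "t e" "h e"]
      G2.finite_edges th2 G2.ends_subset by (auto simp: delete_edge_def B_def)
  have flow1: "?c A 1" if "admits_S1_flow G1"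
    unfolding A_def using that admits_S1_flow_iff_carries[of G1 t h "t e" "h e"]
      G1.finite_edges th1 G1.ends_subset e carries_delete_edge[of "edges G1" e t h] by auto
  have flow2: "?c B 1" if "admits_S1_flow G2"
    unfolding B_def using that admits_S1_flow_iff_carries[of G2 t h "t e" "h e"]
      G2.finite_edges th2 G2.ends_subset e carries_delete_edge[of "edges G2" e t h] by auto
  have ce: "?c {e} 1" by (rule carries_edge) simp
  \<comment> \<open>A unit vector sent through \<open>A \<union> B\<close> is returned by \<open>e\<close>.\<close>
  have close: "admits_S1_flow G" if "?c (A \<union> B) 1"
    unfolding G all by (rule carries_union_cancel[OF that ce]) (use finAB in auto)
  have eq: "admits_S1_flow G" if "?c A r" "?c B r" "r \<ge> 1" for r
    by (rule close, rule carries_union_isosceles[OF that(1,2) _ fin]) (use that(3) in simp)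
  have null1: "admits_S1_flow G" if "?c A 0" "?c B 1"
    by (rule close, rule carries_union_null[OF that _ fin]) simp
  have null2: "admits_S1_flow G" if "?c A 1" "?c B 0"
    using carries_union_null[OF that(2,1)] fin close by (auto simp: Un_commute Int_commute)
  show ?thesis
  proof (intro conjI impI; elim conjE)
    assume "admits_S1_flow G1" "admits_S1_flow G2"
    with flow1 flow2 show "admits_S1_flow G" by (intro eq[of 1]) auto
  next
    assume "admits_S1_flow G1" "admits_S1_flow G2"
    with flow1 flow2 show "admits_S1_flow (delete_edge G e)"
      unfolding Ge by (intro carries_union_cancel[where r = 1] fin) auto
  next
    assume "admits_nz3_flow (contract_edge G1 e)" "admits_S1_flow G2"
    then show "admits_S1_flow G"
      using carries_of_contract(1)[OF assms(2) e(1) th1] flow2 null1 eq[of 1]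
      unfolding A_def[symmetric] by auto
  next
    assume "admits_S1_flow G1" "admits_S1_flow (delete_edge G2 e)"
    then show "admits_S1_flow G" using flow1 null2 G2e by blast
  next
    assume "bridgeless G1" "bridgeless G2"
      "admits_nz3_flow (contract_edge G1 e)" "admits_nz3_flow (contract_edge G2 e)"
    then have "?c A 1 \<or> ?c A 0 \<and> ?c A (sqrt 3)" "?c B 1 \<or> ?c B 0 \<and> ?c B (sqrt 3)"
      using carries_of_contract(2)[OF assms(2) e(1) th1] carries_of_contract(2)[OF assms(3) e(2) th2]
      unfolding A_def B_def bridgeless_def by auto
    moreover have "sqrt 3 \<ge> 1" by simp
    ultimately show "admits_S1_flow G" using eq null1 null2 by (metis order_refl)
  qed
qed

end
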